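(* Let $S(x):=1+\sum_{n\ge 1}|\mathcal{B}_n|\,x^n$, where $\mathcal{B}_n$ is the set of colored Dyck paths of length $n$ defined in the context. Then, as formal power series, $$S(x)=\frac{1-4x+\sqrt{-16x^3+20x^2-8x+1}}{2(x-1)(4x-1)}.$$
   Context: A Dyck path of length $n$ is a lattice path from $(0,0)$ to $(n,n)$ with east steps $(1,0)$ and north steps $(0,1)$ not passing above the diagonal $y=x$. It is encoded as $D=h_1h_2\cdots h_n$, where $h_i$ is the height of its $i$-th east step; thus $h_1\le h_2\le\cdots\le h_n$ and $0\le h_i\le i-1$ for all $i$. A colored Dyck path is a Dyck path each of whose east steps is colored black or red. $\mathcal{A}_n$ is the set of colored Dyck paths of length $n$ such that (a) all east steps of height $0$ are colored red, and (b) the first east step of each positive height is colored black. $\mathcal{B}_n$ is the set of colored Dyck paths in $\mathcal{A}_n$ such that only the east steps of smallest positive height can have two colors (i.e. all east steps whose height is positive and larger than the smallest positive height occurring in the path are black). Relation to pattern avoidance: an inversion sequence of length $n$ is an integer sequence $e=(e_1,\dots,e_n)$ with $0\le e_i\le i-1$. It avoids a word $P=p_1\cdots p_k$ if no subsequence $e_{i_1}\cdots e_{i_k}$ ($i_1<\cdots<i_k$) is order isomorphic to $P$. The set $\mathbf{I}_n(021,120)$ of inversion sequences of length $n$ avoiding both $021$ and $120$ is in bijection with $\mathcal{B}_n$ via $e\mapsto h_1\cdots h_n$, where $h_i=e_i$ (black) if $e_i>0$, and $h_i=\max\{e_1,\dots,e_i\}$ colored red if $e_i=0$. The square root denotes the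 formal power series with constant term $1$. *)

theory Defs
  imports "HOL-Computational_Algebra.Formal_Power_Series"
begin

datatype color = Black | Red

text \<open>
  A Dyck path is represented by the heights $h_1 \ldots h_n$ of its east steps, and a colored
  Dyck path by the list of pairs (height, color) of its east steps. Lists are indexed from 0,
  so the condition $h_i \le i - 1$ becomes \<open>h ! i \<le> i\<close>.
\<close>

definition dyck_path :: "nat \<Rightarrow> nat list \<Rightarrow> bool" where
  "dyck_path n h \<longleftrightarrow> length h = n \<and> sorted h \<and> (\<forall>i<n. h ! i \<le> i)"

definition colored_dyck_paths :: "nat \<Rightarrow> (nat \<times> color) list set" where
  "colored_dyck_paths n = {D. dyck_path n (map fst D)}"

definition A_paths :: "nat \<Rightarrow> (nat \<times> color) list set" where
  "A_paths n = {D \<in> colored_dyck_paths n.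
     (\<forall>i<n. fst (D ! i) = 0 \<longrightarrow> snd (D ! i) = Red) \<and>
     (\<forall>i<n. 0 < fst (D ! i) \<and> (\<forall>j<i. fst (D ! j) \<noteq> fst (D ! i)) \<longrightarrow> snd (D ! i) = Black)}"

text \<open>Only meaningful if some positive height occurs in the path.\<close>

definition min_pos_height :: "(nat \<times> color) list \<Rightarrow> nat" where
  "min_pos_height D = Min {h \<in> fst ` set D. 0 < h}"

definition B_paths :: "nat \<Rightarrow> (nat \<times> color) list set" where
  "B_paths n = {D \<in> A_paths n.
     \<forall>i<n. 0 < fst (D ! i) \<and> min_pos_height D < fst (D ! i) \<longrightarrow> snd (D ! i) = Black}"

definition S :: "real fps" where
  "S = 1 + Abs_fps (\<lambda>n. if n \<ge> 1 then of_nat (card (B_paths n)) else 0)"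

text \<open>
  For a radicand with constant term 1,
  \<open>fps_radical root 2\<close> selects the square root with constant term 1.
\<close>

definition fps_sqrt :: "real fps \<Rightarrow> real fps" where
  "fps_sqrt f = fps_radical root 2 f"

lemma fps_sqrt_square:
  assumes "fps_nth f 0 = 1"
  shows "fps_sqrt f ^ 2 = f" and "fps_nth (fps_sqrt f) 0 = 1"
  using power_radical[of f root 1] assms by (auto simp: fps_sqrt_def numeral_2_eq_2)

end

theory Submission
  imports Defs
begin

text \<open>
  The radicand factors as $(1-4x)(1-2x)^2$, so the claimed identity says
  $2(1-x)S = 1 + (1-2x)/\sqrt{1-4x}$. As $1/\sqrt{1-4x}$ is the generating function of the
  central binomial coefficients, comparing coefficients turns this into
  $|B_{n+1}| = |B_n| + \binom{2n}{n+1}$ (\<open>card_B_paths_Suc\<close>).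

  To prove this, refine the count by the largest height: let $u(n,h)$ be the number of paths in
  $B_n$ with all heights at most $h$. Removing the last east step gives a Pascal-like recurrence
  \[u(n+1,h+1) = u(n+1,h) + u(n,h+1) + (2^{n-h-1} - 1) \qquad (h < n).\]
  Here $u(n,h+1)$ counts the paths whose last step is black of height $h+1$. The last summand
  counts those whose last step is red of height $h+1$: such a step forces $h+1$ to be the smallest
  positive height as well, so the path without it uses only the heights $0$ and $h+1$
  (\<open>card_low_paths_Suc\<close>).

  The inhomogeneous term depends on $n-h$ only, so the diagonal differences
  $u(n+1,h+1) - u(n,h)$ satisfy Pascal's recurrence without it. They are the sums of
  binomial coefficients $\sum_{k=h+1}^{n+1} \binom{n+h}{k}$, which is proved by induction
  (\<open>card_low_paths_diagonal_step\<close>). For $h = n$ only $\binom{2n}{n+1}$ is left of this sum,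
  and both values of $u$ count all paths.
\<close>

section \<open>Removing the last east step\<close>

lemma length_B_paths: "D \<in> B_paths n \<Longrightarrow> length D = n"
  by (auto simp: B_paths_def A_paths_def colored_dyck_paths_def dyck_path_def)

lemma B_paths_height_le:
  assumes "D \<in> B_paths n" "p \<in> set D"
  shows "fst p < n"
proof -
  have D: "length D = n" "\<forall>i<n. map fst D ! i \<le> i"
    using assms(1)
    by (auto simp: B_paths_def A_paths_def colored_dyck_paths_def dyck_path_def)
  obtain i where "i < n" "p = D ! i"
    using assms(2) D(1) by (auto simp: in_set_conv_nth)
  then show ?thesis
    using D by fastforce
qed

lemma finite_B_paths: "finite (B_paths n)"
proof (rule finite_subset)
  show "B_paths n \<subseteq> {D. set D \<subseteq> {..<n} \<times> {Black, Red} \<and> length D = n}"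
  proof (intro subsetI CollectI conjI)
    fix D p assume "D \<in> B_paths n" "p \<in> set D"
    then have "fst p < n" by (rule B_paths_height_le)
    then show "p \<in> {..<n} \<times> {Black, Red}"
      by (cases p; cases "snd p") auto
  qed (rule length_B_paths)
  show "finite {D. set D \<subseteq> {..<n} \<times> {Black, Red} \<and> length D = n}"
    by (rule finite_lists_length_eq) simp
qed

lemma min_pos_height_less_iff:
  assumes "p \<in> set D" "0 < fst p"
  shows "min_pos_height D < x \<longleftrightarrow> (\<exists>q\<in>set D. 0 < fst q \<and> fst q < x)"
proof -
  have "{h \<in> fst ` set D. 0 < h} \<noteq> {}" using assms by auto
  then show ?thesis
    unfolding min_pos_height_def by (subst Min_less_iff) (auto simp: image_iff)
qed

text \<open>
  The conditions on colors are regrouped by step: a red step of positive height must repeat an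
  earlier height, and that height must be the smallest positive one. Phrasing the latter as a
  comparison with all steps avoids \<open>Min\<close>, whose value is unspecified when all heights are \<open>0\<close>.
\<close>

definition valid_step :: "(nat \<times> color) list \<Rightarrow> nat \<Rightarrow> bool" where
  "valid_step D i \<longleftrightarrow> fst (D ! i) \<le> i \<and>
     (fst (D ! i) = 0 \<longrightarrow> snd (D ! i) = Red) \<and>
     (0 < fst (D ! i) \<and> snd (D ! i) = Red \<longrightarrow>
        (\<exists>j<i. fst (D ! j) = fst (D ! i)) \<and> (\<forall>q\<in>set D. fst q = 0 \<or> fst (D ! i) \<le> fst q))"

lemma B_paths_iff:
  "D \<in> B_paths n \<longleftrightarrow> length D = n \<and> sorted (map fst D) \<and> (\<forall>i<n. valid_step D i)"
proof (cases "length D = n")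
  case True
  have Black_iff: "c = Black \<longleftrightarrow> c \<noteq> Red" for c
    by (cases c) auto
  have valid: "valid_step D i \<longleftrightarrow> fst (D ! i) \<le> i \<and>
      (fst (D ! i) = 0 \<longrightarrow> snd (D ! i) = Red) \<and>
      (0 < fst (D ! i) \<and> (\<forall>j<i. fst (D ! j) \<noteq> fst (D ! i)) \<longrightarrow> snd (D ! i) = Black) \<and>
      (0 < fst (D ! i) \<and> min_pos_height D < fst (D ! i) \<longrightarrow> snd (D ! i) = Black)"
    if "i < n" for i
  proof (cases "fst (D ! i) = 0")
    case True
    then show ?thesis by (simp add: valid_step_def)
  next
    case False
    have taut: "(p \<and> \<not> q \<longrightarrow> \<not> r) \<and> (p \<and> \<not> m \<longrightarrow> \<not> r) \<longleftrightarrow> (p \<and> r \<longrightarrow> q \<and> m)" for p q r m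
      by blast
    have min: "min_pos_height D < fst (D ! i) \<longleftrightarrow>
        \<not> (\<forall>q\<in>set D. fst q = 0 \<or> fst (D ! i) \<le> fst q)"
      using min_pos_height_less_iff[of "D ! i" D "fst (D ! i)"] that \<open>length D = n\<close> False
      by (simp add: not_le)
    have first: "(\<forall>j<i. fst (D ! j) \<noteq> fst (D ! i)) \<longleftrightarrow> \<not> (\<exists>j<i. fst (D ! j) = fst (D ! i))"
      by blast
    show ?thesis
      unfolding valid_step_def Black_iff min first taut ..
  qed
  have "dyck_path n (map fst D) \<longleftrightarrow> sorted (map fst D) \<and> (\<forall>i<n. fst (D ! i) \<le> i)"
    using True by (simp add: dyck_path_def)
  then have "D \<in> B_paths n \<longleftrightarrow> sorted (map fst D) \<and> (\<forall>i<n. fst (D ! i) \<le> i \<and>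
      (fst (D ! i) = 0 \<longrightarrow> snd (D ! i) = Red) \<and>
      (0 < fst (D ! i) \<and> (\<forall>j<i. fst (D ! j) \<noteq> fst (D ! i)) \<longrightarrow> snd (D ! i) = Black) \<and>
      (0 < fst (D ! i) \<and> min_pos_height D < fst (D ! i) \<longrightarrow> snd (D ! i) = Black))"
    by (simp only: B_paths_def A_paths_def colored_dyck_paths_def mem_Collect_eq
        all_conj_distrib imp_conjR conj_assoc)
  then show ?thesis
    using True valid by (simp only: simp_thms cong: all_cong imp_cong)
next
  case False
  then show ?thesis using length_B_paths by blast
qed

lemma B_paths_0: "B_paths 0 = {[]}"
  by (auto simp: B_paths_iff)

text \<open>
  All recurrences below rest on this equivalence. No condition on a step of \<open>D\<close> is affected by a
  further step of maximal height: for the smallest positive height this is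
  because \<open>h\<close> cannot lie strictly between \<open>0\<close> and a height occurring in \<open>D\<close>.
\<close>

lemma snoc_in_B_paths_iff:
  "D @ [(h, c)] \<in> B_paths (Suc n) \<longleftrightarrow>
     D \<in> B_paths n \<and> h \<le> n \<and> (\<forall>p\<in>set D. fst p \<le> h) \<and>
     (h = 0 \<longrightarrow> c = Red) \<and>
     (0 < h \<and> c = Red \<longrightarrow> h \<in> fst ` set D \<and> (\<forall>p\<in>set D. fst p = 0 \<or> fst p = h))"
proof (cases "length D = n \<and> (\<forall>p\<in>set D. fst p \<le> h)")
  case True
  then have len: "length D = n" and le: "\<forall>p\<in>set D. fst p \<le> h" by auto
  have sorted: "sorted (map fst (D @ [(h, c)])) \<longleftrightarrow> sorted (map fst D)"
    using le by (auto simp: sorted_append)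
  have nth: "(D @ [(h, c)]) ! j = D ! j" if "j < n" for j
    using len that by (simp add: nth_append)
  have old: "valid_step (D @ [(h, c)]) i \<longleftrightarrow> valid_step D i" if "i < n" for i
  proof -
    have "fst (D ! i) \<le> h" using le len that by simp
    moreover have "(\<exists>j<i. fst ((D @ [(h, c)]) ! j) = x) \<longleftrightarrow> (\<exists>j<i. fst (D ! j) = x)" for x
      by (intro ex_cong1 conj_cong refl) (simp add: nth less_trans[OF _ that])
    moreover have "(\<forall>q\<in>set (D @ [(h, c)]). fst q = 0 \<or> fst (D ! i) \<le> fst q) \<longleftrightarrow>
        (\<forall>q\<in>set D. fst q = 0 \<or> fst (D ! i) \<le> fst q)"
      using \<open>fst (D ! i) \<le> h\<close> by simp
    ultimately show ?thesis
      unfolding valid_step_def nth[OF that] by simp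
  qed
  have new: "valid_step (D @ [(h, c)]) n \<longleftrightarrow> h \<le> n \<and> (h = 0 \<longrightarrow> c = Red) \<and>
     (0 < h \<and> c = Red \<longrightarrow> h \<in> fst ` set D \<and> (\<forall>p\<in>set D. fst p = 0 \<or> fst p = h))"
  proof -
    have "(\<exists>j<n. fst ((D @ [(h, c)]) ! j) = h) \<longleftrightarrow> (\<exists>j<n. fst (D ! j) = h)"
      by (intro ex_cong1 conj_cong refl) (simp add: nth)
    also have "\<dots> \<longleftrightarrow> h \<in> fst ` set D"
      using in_set_conv_nth[of h "map fst D"] len by (simp add: conj_commute cong: conj_cong)
    finally have occurs: "(\<exists>j<n. fst ((D @ [(h, c)]) ! j) = h) \<longleftrightarrow> h \<in> fst ` set D" .
    have last: "(D @ [(h, c)]) ! n = (h, c)" using len by (simp add: nth_append)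
    have only: "(\<forall>q\<in>set D. fst q = 0 \<or> h \<le> fst q) \<longleftrightarrow>
        (\<forall>q\<in>set D. fst q = 0 \<or> fst q = h)"
      by (intro ball_cong refl) (use le in \<open>force intro: order_antisym\<close>)
    show ?thesis
      unfolding valid_step_def last fst_conv snd_conv occurs by (simp add: only)
  qed
  have "D @ [(h, c)] \<in> B_paths (Suc n) \<longleftrightarrow>
      sorted (map fst D) \<and> valid_step (D @ [(h, c)]) n \<and> (\<forall>i<n. valid_step D i)"
    unfolding B_paths_iff[of _ "Suc n"] sorted All_less_Suc
    using len old by auto
  then show ?thesis
    unfolding new B_paths_iff[of _ n] using len le by argo
next
  case False
  then show ?thesis
    by (auto simp: B_paths_iff[of _ "Suc n"] sorted_append dest: length_B_paths)
qed

definition low_paths :: "nat \<Rightarrow> nat \<Rightarrow> (nat \<times> color) list set" where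
  "low_paths n h = {D \<in> B_paths n. \<forall>p\<in>set D. fst p \<le> h}"

text \<open>
  For positive \<open>h\<close>, these are the paths to which a red step of height \<open>h\<close> can be appended.
\<close>

definition single_height_paths :: "nat \<Rightarrow> nat \<Rightarrow> (nat \<times> color) list set" where
  "single_height_paths n h =
     {D \<in> B_paths n. h \<in> fst ` set D \<and> (\<forall>p\<in>set D. fst p = 0 \<or> fst p = h)}"

abbreviation append_step :: "nat \<Rightarrow> color \<Rightarrow> (nat \<times> color) list \<Rightarrow> (nat \<times> color) list" where
  "append_step h c D \<equiv> D @ [(h, c)]"

lemma finite_low_paths: "finite (low_paths n h)"
  and finite_single_height_paths: "finite (single_height_paths n h)"
  using finite_B_paths by (auto simp: low_paths_def single_height_paths_def)

lemma B_paths_Suc_snocE: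
  assumes "D \<in> B_paths (Suc n)"
  obtains D' h c where "D = append_step h c D'"
  using length_B_paths[OF assms] by (cases D rule: rev_cases) auto

lemma card_append_step: "card (append_step h c ` A) = card A"
  by (rule card_image) (simp add: inj_on_def)

text \<open>
  The last of \<open>n\<close> steps has height at most \<open>n - 1\<close>, so the bound \<open>h\<close> is no restriction from
  \<open>h = n - 1\<close> on.
\<close>

lemma low_paths_top:
  assumes "n \<le> Suc h"
  shows "low_paths n h = B_paths n"
  using B_paths_height_le[of _ n] assms by (fastforce simp: low_paths_def)

lemma low_paths_0_right: "card (low_paths n 0) = 1"
proof (induction n)
  case 0
  have "low_paths 0 0 = {[]}" by (auto simp: low_paths_def B_paths_0)
  then show ?case by simp
next
  case (Suc n)
  have "low_paths (Suc n) 0 = append_step 0 Red ` low_paths n 0"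
  proof (intro equalityI subsetI)
    fix D assume D: "D \<in> low_paths (Suc n) 0"
    then have "D \<in> B_paths (Suc n)" by (simp add: low_paths_def)
    then obtain D' h c where "D = append_step h c D'" by (rule B_paths_Suc_snocE)
    then show "D \<in> append_step 0 Red ` low_paths n 0"
      using D by (auto simp: low_paths_def snoc_in_B_paths_iff)
  qed (auto simp: low_paths_def snoc_in_B_paths_iff)
  then show ?case
    using Suc by (simp add: card_append_step)
qed

text \<open>
  A black last step may be the first one of height \<open>h\<close>, in which case it follows a path of
  height \<open>0\<close>; a red one may not.
\<close>

lemma single_height_paths_Suc:
  assumes "0 < h" "h \<le> n"
  shows "single_height_paths (Suc n) h =
    append_step h Black ` (low_paths n 0 \<union> single_height_paths n h)
    \<union> append_step h Red ` single_height_paths n h" (is "?L = ?R")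
proof (intro equalityI subsetI)
  fix D assume D: "D \<in> ?L"
  then have "D \<in> B_paths (Suc n)" by (simp add: single_height_paths_def)
  then obtain D' k c where D': "D = append_step k c D'" by (rule B_paths_Suc_snocE)
  have "k = 0 \<or> k = h" "h \<le> k"
    using D unfolding D' single_height_paths_def mem_Collect_eq snoc_in_B_paths_iff by auto
  then have "k = h" using assms by simp
  then show "D \<in> ?R"
    using D assms unfolding D' single_height_paths_def low_paths_def
    by (cases c) (auto simp: snoc_in_B_paths_iff image_iff)
next
  have Black: "append_step h Black D' \<in> ?L" if "D' \<in> low_paths n 0 \<union> single_height_paths n h" for D'
  proof -
    have "D' \<in> B_paths n" "\<forall>p\<in>set D'. fst p = 0 \<or> fst p = h"
      using that by (auto simp: low_paths_def single_height_paths_def)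
    moreover from this have "\<forall>p\<in>set D'. fst p \<le> h" by (metis le0 order_refl)
    ultimately show ?thesis
      using assms by (simp add: single_height_paths_def snoc_in_B_paths_iff)
  qed
  have Red: "append_step h Red D' \<in> ?L" if "D' \<in> single_height_paths n h" for D'
  proof -
    have "D' \<in> B_paths n" "h \<in> fst ` set D'" "\<forall>p\<in>set D'. fst p = 0 \<or> fst p = h"
      using that by (simp_all add: single_height_paths_def)
    moreover from this have "\<forall>p\<in>set D'. fst p \<le> h" by (metis le0 order_refl)
    ultimately show ?thesis
      using assms by (simp add: single_height_paths_def snoc_in_B_paths_iff)
  qed
  fix D assume "D \<in> ?R"
  then show "D \<in> ?L" using Black Red by blast
qed

lemma single_height_paths_empty:
  assumes "n \<le> h"
  shows "single_height_paths n h = {}"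
  using B_paths_height_le[of _ n] assms by (fastforce simp: single_height_paths_def)

lemma card_single_height_paths:
  assumes "0 < h" "h \<le> n"
  shows "card (single_height_paths n h) + 1 = 2 ^ (n - h)"
  using assms(2)
proof (induction n rule: dec_induct)
  case base
  show ?case by (simp add: single_height_paths_empty)
next
  case (step n)
  have disj: "low_paths n 0 \<inter> single_height_paths n h = {}"
    using assms by (auto simp: low_paths_def single_height_paths_def)
  have "card (single_height_paths (Suc n) h) =
      (card (low_paths n 0) + card (single_height_paths n h)) + card (single_height_paths n h)"
    unfolding single_height_paths_Suc[OF assms(1) step(1)]
    by (subst card_Un_disjoint)
      (auto simp: finite_low_paths finite_single_height_paths card_append_step
        card_Un_disjoint[OF finite_low_paths finite_single_height_paths disj])
  then show ?case
    using step by (simp add: low_paths_0_right Suc_diff_le)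
qed

text \<open>
  Either the last step, which has the largest height, stays below \<open>Suc h\<close>, or it is removed. The
  condition \<open>h < n\<close> says that the last step can reach the height \<open>Suc h\<close> at all.
\<close>

lemma low_paths_Suc:
  assumes "h < n"
  shows "low_paths (Suc n) (Suc h) =
    low_paths (Suc n) h \<union>
    (append_step (Suc h) Black ` low_paths n (Suc h)
     \<union> append_step (Suc h) Red ` single_height_paths n (Suc h))" (is "?L = ?R")
proof (intro equalityI subsetI)
  fix D assume D: "D \<in> ?L"
  then have "D \<in> B_paths (Suc n)" by (simp add: low_paths_def)
  then obtain D' k c where D': "D = append_step k c D'" by (rule B_paths_Suc_snocE)
  show "D \<in> ?R"
  proof (cases "k = Suc h")
    case True
    then show ?thesis
      using D unfolding D' single_height_paths_def low_paths_def
      by (cases c) (auto simp: snoc_in_B_paths_iff image_iff)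
  next
    case False
    then have "k \<le> h" "\<forall>p\<in>set D'. fst p \<le> k"
      using D unfolding D' low_paths_def by (auto simp: snoc_in_B_paths_iff)
    then have "D \<in> low_paths (Suc n) h"
      using D unfolding D' low_paths_def by auto
    then show ?thesis by blast
  qed
next
  have low: "D \<in> ?L" if "D \<in> low_paths (Suc n) h" for D
    using that by (auto simp: low_paths_def le_SucI)
  have Black: "append_step (Suc h) Black D' \<in> ?L" if "D' \<in> low_paths n (Suc h)" for D'
    using that assms by (simp add: low_paths_def snoc_in_B_paths_iff)
  have Red: "append_step (Suc h) Red D' \<in> ?L" if "D' \<in> single_height_paths n (Suc h)" for D'
  proof -
    have "D' \<in> B_paths n" "Suc h \<in> fst ` set D'" "\<forall>p\<in>set D'. fst p = 0 \<or> fst p = Suc h"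
      using that by (simp_all add: single_height_paths_def)
    moreover from this have "\<forall>p\<in>set D'. fst p \<le> Suc h" by (metis le0 order_refl)
    ultimately show ?thesis
      using assms by (simp add: low_paths_def snoc_in_B_paths_iff)
  qed
  fix D assume "D \<in> ?R"
  then show "D \<in> ?L" using low Black Red by blast
qed

lemma card_low_paths_Suc:
  assumes "h < n"
  shows "card (low_paths (Suc n) (Suc h)) + 1 =
    card (low_paths (Suc n) h) + card (low_paths n (Suc h)) + 2 ^ (n - Suc h)"
proof -
  let ?B = "append_step (Suc h) Black ` low_paths n (Suc h)"
  let ?R = "append_step (Suc h) Red ` single_height_paths n (Suc h)"
  have "card (low_paths (Suc n) (Suc h)) = card (low_paths (Suc n) h) + card (?B \<union> ?R)"
    unfolding low_paths_Suc[OF assms]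
    by (rule card_Un_disjoint)
      (use finite_low_paths finite_single_height_paths in \<open>auto simp: low_paths_def\<close>)
  also have "card (?B \<union> ?R) = card ?B + card ?R"
    by (rule card_Un_disjoint)
      (use finite_low_paths finite_single_height_paths in auto)
  finally have "card (low_paths (Suc n) (Suc h)) = card (low_paths (Suc n) h) +
      (card (low_paths n (Suc h)) + card (single_height_paths n (Suc h)))"
    by (simp add: card_append_step)
  then show ?thesis
    using card_single_height_paths[of "Suc h" n] assms by simp
qed

section \<open>Solving the recurrence\<close>

text \<open>
  The solution for the diagonal differences, suggested by its first column
  $2^n - 1 = \sum_{k=1}^{n+1} \binom{n}{k}$: in row $n+h$ of Pascal's triangle, the entries with
  lower index in $\{h+1,\dots,n+1\}$. It vanishes just above the diagonal, at $h = n+1$.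
\<close>

definition binomial_window :: "nat \<Rightarrow> nat \<Rightarrow> nat" where
  "binomial_window n h = (\<Sum>k=h..n. (n + h) choose Suc k)"

lemma binomial_window_0_right: "binomial_window n 0 + 1 = 2 ^ n"
proof -
  have "2 ^ n = (\<Sum>k\<le>Suc n. n choose k)"
    by (simp add: choose_row_sum[symmetric])
  also have "\<dots> = 1 + (\<Sum>k\<le>n. n choose Suc k)"
    by (subst sum.atMost_Suc_shift) simp
  finally show ?thesis
    by (simp add: binomial_window_def atLeast0AtMost)
qed

lemma binomial_window_diagonal: "binomial_window n n = (2 * n) choose Suc n"
  by (simp add: binomial_window_def mult_2)

text \<open>
  Pascal's rule splits the window on the left into two windows of the row \<open>m = n + h + 1\<close>, with
  indices \<open>h + 1..n + 1\<close> and \<open>h + 2..n + 2\<close>. Exchanging their upper ends gives the windows on the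
  right, \<open>h + 1..n + 2\<close> and \<open>h + 2..n + 1\<close>.
\<close>

lemma binomial_window_pascal:
  assumes "h \<le> n"
  shows "binomial_window (Suc n) (Suc h) = binomial_window (Suc n) h + binomial_window n (Suc h)"
proof -
  define m where "m = Suc (n + h)"
  have "binomial_window (Suc n) (Suc h) =
      (\<Sum>k=Suc h..Suc n. m choose k) + (\<Sum>k=Suc h..Suc n. m choose Suc k)"
    by (simp add: binomial_window_def m_def sum.distrib)
  also have "(\<Sum>k=Suc h..Suc n. m choose k) = (\<Sum>k=h..n. m choose Suc k)"
    by (rule sum.shift_bounds_cl_Suc_ivl)
  also have "(\<Sum>k=h..n. m choose Suc k) + (\<Sum>k=Suc h..Suc n. m choose Suc k) =
      (\<Sum>k=h..Suc n. m choose Suc k) + (\<Sum>k=Suc h..n. m choose Suc k)"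
    using assms by (simp add: sum.atLeast_Suc_atMost[of h] sum.nat_ivl_Suc')
  finally show ?thesis
    by (simp add: binomial_window_def m_def)
qed

text \<open>
  The difference of two instances of the recurrence for the number of low paths, one diagonal step
  apart, is the Pascal recurrence of the windows, as the powers of two cancel. It remains to check
  the two boundaries: for \<open>h = 0\<close> both sides are explicit, and on the diagonal \<open>h = n\<close> the
  number of low paths no longer changes with \<open>h\<close>, in accordance with the empty window there.
\<close>

lemma card_low_paths_diagonal_step:
  assumes "h \<le> n"
  shows "card (low_paths (Suc n) (Suc h)) = card (low_paths n h) + binomial_window n h"
  using assms
proof (induction n arbitrary: h)
  case 0
  then show ?case
    using low_paths_top[of 1 1] low_paths_top[of 1 0] low_paths_0_right[of 0]
      low_paths_0_right[of 1] by (simp add: binomial_window_def)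
next
  case (Suc n)
  note outer = Suc.IH
  show ?case
    using Suc.prems
  proof (induction h)
    case 0
    have "card (low_paths (Suc (Suc n)) 1) + 1 = 1 + card (low_paths (Suc n) 1) + 2 ^ n"
      using card_low_paths_Suc[of 0 "Suc n"] by (simp add: low_paths_0_right)
    moreover have "card (low_paths (Suc n) 1) + 1 = 1 + 2 ^ n"
      using outer[of 0] binomial_window_0_right[of n] by (simp add: low_paths_0_right)
    ultimately show ?case
      using binomial_window_0_right[of "Suc n"] by (simp add: low_paths_0_right)
  next
    case (Suc h)
    have inner: "card (low_paths (Suc (Suc n)) (Suc h)) =
        card (low_paths (Suc n) h) + binomial_window (Suc n) h"
      using Suc by simp
    have pascal: "binomial_window (Suc n) (Suc h) =
        binomial_window (Suc n) h + binomial_window n (Suc h)"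
      using Suc.prems by (intro binomial_window_pascal) simp
    show ?case
    proof (cases "h < n")
      case True
      have "card (low_paths (Suc (Suc n)) (Suc (Suc h))) + 1 =
          card (low_paths (Suc (Suc n)) (Suc h)) + card (low_paths (Suc n) (Suc (Suc h)))
          + 2 ^ (n - Suc h)"
        using card_low_paths_Suc[of "Suc h" "Suc n"] True by simp
      moreover have "card (low_paths (Suc n) (Suc h)) + 1 =
          card (low_paths (Suc n) h) + card (low_paths n (Suc h)) + 2 ^ (n - Suc h)"
        using True by (rule card_low_paths_Suc)
      moreover have "card (low_paths (Suc n) (Suc (Suc h))) =
          card (low_paths n (Suc h)) + binomial_window n (Suc h)"
        using True by (intro outer) simp
      ultimately show ?thesis
        using inner pascal by simp
    next
      case False
      then have "h = n" using Suc.prems by simp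
      moreover have "binomial_window n (Suc n) = 0"
        by (simp add: binomial_window_def)
      ultimately show ?thesis
        using inner pascal by (simp add: low_paths_top)
    qed
  qed
qed

lemma card_B_paths_Suc: "card (B_paths (Suc n)) = card (B_paths n) + ((2 * n) choose Suc n)"
  using card_low_paths_diagonal_step[of n n]
  by (simp add: low_paths_top binomial_window_diagonal)

section \<open>The generating function\<close>

definition central_binomial_fps :: "real fps" where
  "central_binomial_fps = Abs_fps (\<lambda>n. of_nat ((2 * n) choose n))"

lemma Suc_times_central_binomial_Suc:
  "Suc n * ((2 * Suc n) choose Suc n) = 2 * (2 * n + 1) * ((2 * n) choose n)"
proof -
  have sym: "Suc (2 * n) choose Suc n = Suc (2 * n) choose n"
    using binomial_symmetric[of "Suc n" "Suc (2 * n)"] by simp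
  \<comment> \<open>The additional factor \<open>Suc n\<close> allows the absorption rule to be applied twice.\<close>
  have "Suc n * (Suc n * ((2 * Suc n) choose Suc n)) =
      Suc n * (Suc (Suc (2 * n)) * (Suc (2 * n) choose n))"
    using Suc_times_binomial[of n "Suc (2 * n)"] by (simp only: mult_Suc_right add_2_eq_Suc)
  also have "\<dots> = Suc (Suc (2 * n)) * (Suc n * (Suc (2 * n) choose Suc n))"
    by (simp only: sym mult.left_commute)
  also have "\<dots> = Suc (Suc (2 * n)) * (Suc (2 * n) * ((2 * n) choose n))"
    by (simp only: Suc_times_binomial)
  also have "\<dots> = Suc n * (2 * (2 * n + 1) * ((2 * n) choose n))"
    by (simp add: algebra_simps)
  finally show ?thesis
    by (simp only: mult_cancel1 nat.distinct simp_thms)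
qed

text \<open>
  The recurrence of the central binomial coefficients says that the series $Z$ satisfies
  $(1-4x)Z' = 2Z$. Hence $(1-4x)Z^2$ has derivative $0$ and equals its constant term.
\<close>

lemma central_binomial_fps_square:
  "(1 - 4 * fps_X) * central_binomial_fps ^ 2 = 1"
proof -
  let ?Z = central_binomial_fps
  have ode: "(1 - 4 * fps_X) * fps_deriv ?Z = 2 * ?Z"
  proof (rule fps_ext)
    fix n
    have expand: "(1 - 4 * fps_X) * F = F - fps_const 4 * (fps_X * F)" for F :: "real fps"
      by (simp add: numeral_fps_const algebra_simps)
    have "real (Suc n * ((2 * Suc n) choose Suc n)) = real (2 * (2 * n + 1) * ((2 * n) choose n))"
      by (simp only: Suc_times_central_binomial_Suc)
    then have "real (Suc n) * fps_nth ?Z (Suc n) = (4 * real n + 2) * fps_nth ?Z n"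
      by (simp add: central_binomial_fps_def algebra_simps del: mult_Suc_right binomial_Suc_Suc)
    then show "fps_nth ((1 - 4 * fps_X) * fps_deriv ?Z) n = fps_nth (2 * ?Z) n"
      unfolding expand numeral_fps_const[of "num.Bit0 num.One"]
      by (cases n) (simp_all add: algebra_simps)
  qed
  have "fps_deriv ((1 - 4 * fps_X) * ?Z ^ 2) =
      2 * ?Z * ((1 - 4 * fps_X) * fps_deriv ?Z) - 4 * ?Z ^ 2"
    by (simp add: power2_eq_square algebra_simps)
  also have "\<dots> = 0"
    unfolding ode by (simp add: power2_eq_square algebra_simps)
  finally have "(1 - 4 * fps_X) * ?Z ^ 2 = fps_const (fps_nth ((1 - 4 * fps_X) * ?Z ^ 2) 0)"
    by (simp only: fps_deriv_eq_0_iff)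
  then show ?thesis
    by (simp add: central_binomial_fps_def power2_eq_square)
qed

lemma double_choose_Suc:
  "2 * ((2 * n) choose Suc n) + 2 * ((2 * n) choose n) = (2 * Suc n) choose Suc n"
  using binomial_symmetric[of "Suc n" "Suc (2 * n)"] by simp

text \<open>
  Multiplication by $1-x$ turns the coefficients $|B_n|$ into their differences
  $\binom{2n}{n+1}$, and $2\binom{2n}{n+1}$ is the coefficient
  $\binom{2n+2}{n+1} - 2\binom{2n}{n}$ of $(1-2x)Z$.
\<close>

lemma S_central_binomial:
  "2 * (1 - fps_X) * S = 1 + (1 - 2 * fps_X) * central_binomial_fps"
proof (rule fps_ext)
  fix n
  have S_nth: "fps_nth S k = of_nat (card (B_paths k))" for k
    by (cases k) (auto simp: S_def B_paths_0)
  show "fps_nth (2 * (1 - fps_X) * S) n =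
      fps_nth (1 + (1 - 2 * fps_X) * central_binomial_fps) n"
  proof (cases n)
    case 0
    then show ?thesis
      by (simp add: S_nth B_paths_0 central_binomial_fps_def)
  next
    case (Suc m)
    have expand: "2 * (1 - fps_X) * F = fps_const 2 * (F - fps_X * F)"
      "(1 - 2 * fps_X) * F = F - fps_const 2 * (fps_X * F)" for F :: "real fps"
      by (simp_all add: numeral_fps_const algebra_simps)
    have "real (2 * ((2 * m) choose Suc m) + 2 * ((2 * m) choose m)) =
        real ((2 * Suc m) choose Suc m)"
      by (simp only: double_choose_Suc)
    then show ?thesis
      unfolding expand Suc
      by (simp add: S_nth card_B_paths_Suc central_binomial_fps_def)
  qed
qed

lemma fps_sqrt_unique:
  assumes "a ^ 2 = b" "fps_nth a 0 = 1"
  shows "fps_sqrt b = a"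
proof -
  have "fps_nth b 0 = 1" using assms by (auto simp: power2_eq_square)
  then show ?thesis
    using radical_unique[of root 1 b a] assms
    by (simp add: fps_sqrt_def numeral_2_eq_2)
qed

theorem theorem4p2:
  "S = (1 - 4 * fps_X + fps_sqrt (- 16 * fps_X ^ 3 + 20 * fps_X ^ 2 - 8 * fps_X + 1))
       / (2 * (fps_X - 1) * (4 * fps_X - 1))"
proof -
  let ?Z = central_binomial_fps
  let ?a = "(1 - 4 * fps_X) * (1 - 2 * fps_X) * ?Z"
  let ?den = "2 * (fps_X - 1) * (4 * fps_X - 1) :: real fps"
  have "?a ^ 2 = (1 - 4 * fps_X) * (1 - 2 * fps_X) ^ 2 * ((1 - 4 * fps_X) * ?Z ^ 2)"
    by (simp add: power2_eq_square mult_ac)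
  also have "\<dots> = - 16 * fps_X ^ 3 + 20 * fps_X ^ 2 - 8 * fps_X + 1"
    unfolding central_binomial_fps_square
    by (simp add: power2_eq_square power3_eq_cube algebra_simps)
  finally have sqrt: "fps_sqrt (- 16 * fps_X ^ 3 + 20 * fps_X ^ 2 - 8 * fps_X + 1) = ?a"
    by (rule fps_sqrt_unique) (simp add: central_binomial_fps_def)
  have "S * ?den = (1 - 4 * fps_X) * (2 * (1 - fps_X) * S)"
    by (simp add: algebra_simps)
  also have "\<dots> = 1 - 4 * fps_X + ?a"
    unfolding S_central_binomial by (simp add: algebra_simps)
  finally have prod: "S * ?den = 1 - 4 * fps_X + ?a" .
  have "fps_nth ?den 0 \<noteq> 0" by simp
  then have "?den \<noteq> 0" by (metis fps_zero_nth)
  then have "S = S * ?den / ?den" by simp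
  then show ?thesis
    by (simp only: prod sqrt)
qed

end
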